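(* Assume that the thickness function $d:\partial C\to\mathbb{R}_+$ is a Morse function. Then the number of fixed points of the return map $F:\partial C\to\partial C$ satisfies $$\#\operatorname{Fix}(F)\ \geq\ \sum_{k=0}^{N-1} b_k(\partial C),$$ where $b_k(\partial C)$ denotes the $k$-th Betti number of $\partial C$, i.e. the rank of the homology group $H_k(\partial C)$.
   Context: Setting. $C\subset\mathbb{R}^N$ is a compact convex set with nonempty interior whose boundary $\partial C$ is a compact manifold of class $C^2$, with outward unit normal $\nu$. $\Omega\subset\mathbb{R}^N$ is a bounded domain containing $C$ and belonging to the class $\mathcal{O}_C$: for almost every $x\in\partial\Omega$ where the inward unit normal $n(x)$ to $\partial\Omega$ exists, the half-line $D(x,n(x))=\{x+tn(x):t\ge 0\}$ intersects $C$. Thickness function: $d:\partial C\to\mathbb{R}_+$, $d(c)=\sup\{r\ge 0: c+r\nu(c)\in\Omega\}$, assumed of class $C^2$. Radial map: $\Phi(c)=c+d(c)\nu(c)$, which parametrizes $\partial\Omega\setminus C$ by $\partial C$. Reciprocal map $\pi$: for $x\in\partial\Omega$, $\pi(x)\in\partial C$ is the point of $\partial C$ reached when one moves from $x$ along the half-line $D(x,n(x))$ back to $\partial C$ (its first point in $C$). Return map: $F=\pi\circ\Phi:\partial C\to\partial C$, and $\operatorname{Fix}(F)$ is its set of fixed points. A function on $\partial C$ is Morse if all its critical points are nondegenerate, i.e. the Hessian at each critical point is non-singular. *)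

theory Defs
  imports "HOL-Analysis.Analysis" "HOL-Homology.Homology"
begin

section \<open>Hypersurfaces and functions of class C2\<close>

text \<open>
  In the following, \<open>V\<close> is a relatively open subset of a linear subspace \<open>H\<close>, and derivatives are
  taken within \<open>V\<close>. Such derivatives are determined by the function only on \<open>H\<close>; all notions below
  depend only on their restriction to \<open>H\<close>.
\<close>

definition C2_on :: "'a::real_normed_vector set \<Rightarrow> ('a \<Rightarrow> 'b::real_normed_vector) \<Rightarrow> bool" where
  "C2_on V f \<longleftrightarrow>
     (\<exists>(f' :: 'a \<Rightarrow> 'a \<Rightarrow>\<^sub>L 'b) (f'' :: 'a \<Rightarrow> 'a \<Rightarrow>\<^sub>L 'a \<Rightarrow>\<^sub>L 'b).
        (\<forall>u\<in>V. (f has_derivative blinfun_apply (f' u)) (at u within V)) \<and>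
        (\<forall>u\<in>V. (f' has_derivative blinfun_apply (f'' u)) (at u within V)) \<and>
        continuous_on V f'')"

text \<open>
  A regular local parametrization \<open>\<phi> : V \<rightarrow> S\<close> of class C2, where the parameter domain \<open>V\<close> is an open
  subset of an \<open>(N - 1)\<close>-dimensional linear subspace \<open>H\<close> of the ambient space. Using a subspace
  instead of a separate type of dimension \<open>N - 1\<close> also covers \<open>N = 1\<close>.
\<close>

definition C2_param ::
    "'a::euclidean_space set \<Rightarrow> 'a set \<Rightarrow> 'a set \<Rightarrow> ('a \<Rightarrow> 'a) \<Rightarrow> bool" where
  "C2_param S H V \<phi> \<longleftrightarrow>
     subspace H \<and> dim H + 1 = DIM('a) \<and>
     openin (top_of_set H) V \<and>
     openin (top_of_set S) (\<phi> ` V) \<and>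
     (\<exists>\<psi>. homeomorphism V (\<phi> ` V) \<phi> \<psi>) \<and>
     C2_on V \<phi> \<and>
     (\<forall>u\<in>V. \<forall>D. (\<phi> has_derivative D) (at u within V) \<longrightarrow> inj_on D H)"

definition C2_hypersurface :: "'a::euclidean_space set \<Rightarrow> bool" where
  "C2_hypersurface S \<longleftrightarrow> (\<forall>p\<in>S. \<exists>H V \<phi>. C2_param S H V \<phi> \<and> p \<in> \<phi> ` V)"

definition C2_function_on :: "'a::euclidean_space set \<Rightarrow> ('a \<Rightarrow> real) \<Rightarrow> bool" where
  "C2_function_on S f \<longleftrightarrow> (\<forall>H V \<phi>. C2_param S H V \<phi> \<longrightarrow> C2_on V (f \<circ> \<phi>))"

definition critical_point_on :: "'a::euclidean_space set \<Rightarrow> ('a \<Rightarrow> real) \<Rightarrow> 'a \<Rightarrow> bool" where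
  "critical_point_on S f p \<longleftrightarrow> p \<in> S \<and>
     (\<forall>H V \<phi>. \<forall>u\<in>V. C2_param S H V \<phi> \<and> \<phi> u = p \<longrightarrow>
        (f \<circ> \<phi> has_derivative (\<lambda>_. 0)) (at u within V))"

text \<open>The bilinear form \<open>B\<close> on \<open>H\<close> is the Hessian of \<open>g\<close> at \<open>u\<close>.\<close>

definition nonsingular_Hessian ::
    "'a::euclidean_space set \<Rightarrow> 'a set \<Rightarrow> ('a \<Rightarrow> real) \<Rightarrow> 'a \<Rightarrow> bool" where
  "nonsingular_Hessian H V g u \<longleftrightarrow>
     (\<exists>(g' :: 'a \<Rightarrow> 'a \<Rightarrow>\<^sub>L real) (B :: 'a \<Rightarrow>\<^sub>L 'a \<Rightarrow>\<^sub>L real).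
        (\<forall>v\<in>V. (g has_derivative blinfun_apply (g' v)) (at v within V)) \<and>
        (g' has_derivative blinfun_apply B) (at u within V) \<and>
        (\<forall>h\<in>H. (\<forall>k\<in>H. blinfun_apply (blinfun_apply B h) k = 0) \<longrightarrow> h = 0))"

definition nondegenerate_on :: "'a::euclidean_space set \<Rightarrow> ('a \<Rightarrow> real) \<Rightarrow> 'a \<Rightarrow> bool" where
  "nondegenerate_on S f p \<longleftrightarrow>
     (\<forall>H V \<phi>. \<forall>u\<in>V. C2_param S H V \<phi> \<and> \<phi> u = p \<longrightarrow> nonsingular_Hessian H V (f \<circ> \<phi>) u)"

definition Morse_on :: "'a::euclidean_space set \<Rightarrow> ('a \<Rightarrow> real) \<Rightarrow> bool" where
  "Morse_on S f \<longleftrightarrow> (\<forall>p. critical_point_on S f p \<longrightarrow> nondegenerate_on S f p)"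


section \<open>Normals\<close>

text \<open>
  \<open>n\<close> is the inward unit normal to the boundary of \<open>S\<close> at \<open>x\<close>: near \<open>x\<close>, the set \<open>S\<close> agrees to first
  order with the half-space \<open>{y. (y - x) \<bullet> n \<ge> 0}\<close>, that is, for every \<open>\<epsilon> > 0\<close> the boundary of \<open>S\<close>
  close to \<open>x\<close> lies in the double cone \<open>\<bar>(y - x) \<bullet> n\<bar> \<le> \<epsilon> \<parallel>y - x\<parallel>\<close>. Such an \<open>n\<close> is unique, and for a
  boundary of class C1 with \<open>S\<close> locally on one side it is the classical normal.
\<close>

definition has_inward_normal :: "'a::euclidean_space set \<Rightarrow> 'a \<Rightarrow> 'a \<Rightarrow> bool" where
  "has_inward_normal S x n \<longleftrightarrow> x \<in> frontier S \<and> norm n = 1 \<and>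
     (\<forall>\<epsilon>>0. \<exists>\<delta>>0. \<forall>y. dist y x < \<delta> \<longrightarrow>
        ((y - x) \<bullet> n > \<epsilon> * norm (y - x) \<longrightarrow> y \<in> S) \<and>
        ((y - x) \<bullet> n < - \<epsilon> * norm (y - x) \<longrightarrow> y \<notin> S))"

definition inward_normal :: "'a::euclidean_space set \<Rightarrow> 'a \<Rightarrow> 'a" where
  "inward_normal S x = (THE n. has_inward_normal S x n)"

definition outward_normal :: "'a::euclidean_space set \<Rightarrow> 'a \<Rightarrow> 'a" where
  "outward_normal S x = - inward_normal S x"

definition half_line :: "'a::real_vector \<Rightarrow> 'a \<Rightarrow> 'a set" where
  "half_line x n = {x + t *\<^sub>R n | t. t \<ge> 0}"


section \<open>Hausdorff measure and the class \<open>\<O>\<^sub>C\<close>\<close>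

text \<open>
  The \<open>s\<close>-dimensional Hausdorff outer measure, without normalizing constant. The empty set never
  contributes to a cover, and by \<open>0 ^ 0 = 1\<close> the measure is counting measure for \<open>s = 0\<close>.
\<close>

definition hausdorff_content :: "real \<Rightarrow> nat \<Rightarrow> 'a::metric_space set \<Rightarrow> ennreal" where
  "hausdorff_content \<delta> s E =
     (INF A \<in> {A :: nat \<Rightarrow> 'a set. E \<subseteq> (\<Union>i. A i) \<and> (\<forall>i. bounded (A i) \<and> diameter (A i) \<le> \<delta>)}.
        suminf (\<lambda>i. if A i = {} then 0 else ennreal (diameter (A i) ^ s)))"

definition hausdorff_measure :: "nat \<Rightarrow> 'a::metric_space set \<Rightarrow> ennreal" where
  "hausdorff_measure s E = (SUP \<delta> \<in> {0<..}. hausdorff_content \<delta> s E)"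

text \<open>``Almost every'' refers to the surface measure, i.e. \<open>(N - 1)\<close>-dimensional Hausdorff measure.\<close>

definition class_O :: "'a::euclidean_space set \<Rightarrow> 'a set \<Rightarrow> bool" where
  "class_O C \<Omega> \<longleftrightarrow>
     hausdorff_measure (DIM('a) - 1)
       {x \<in> frontier \<Omega>. (\<exists>n. has_inward_normal \<Omega> x n) \<and>
                         half_line x (inward_normal \<Omega> x) \<inter> C = {}} = 0"


section \<open>Thickness, radial map, reciprocal map, return map\<close>

definition thickness :: "'a::euclidean_space set \<Rightarrow> 'a set \<Rightarrow> 'a \<Rightarrow> real" where
  "thickness C \<Omega> c = Sup {r. r \<ge> 0 \<and> c + r *\<^sub>R outward_normal C c \<in> \<Omega>}"

definition radial_map :: "'a::euclidean_space set \<Rightarrow> 'a set \<Rightarrow> 'a \<Rightarrow> 'a" where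
  "radial_map C \<Omega> c = c + thickness C \<Omega> c *\<^sub>R outward_normal C c"

text \<open>The first point of \<open>C\<close> on the half-line; the infimum is attained when \<open>C\<close> is closed and meets it.\<close>

definition reciprocal_map :: "'a::euclidean_space set \<Rightarrow> 'a set \<Rightarrow> 'a \<Rightarrow> 'a" where
  "reciprocal_map C \<Omega> x =
     x + Inf {t. t \<ge> 0 \<and> x + t *\<^sub>R inward_normal \<Omega> x \<in> C} *\<^sub>R inward_normal \<Omega> x"

definition return_map :: "'a::euclidean_space set \<Rightarrow> 'a set \<Rightarrow> 'a \<Rightarrow> 'a" where
  "return_map C \<Omega> = reciprocal_map C \<Omega> \<circ> radial_map C \<Omega>"

definition fixed_points :: "'a set \<Rightarrow> ('a \<Rightarrow> 'a) \<Rightarrow> 'a set" where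
  "fixed_points S F = {x \<in> S. F x = x}"


section \<open>Cardinalities and Betti numbers\<close>

definition ecard :: "'a set \<Rightarrow> enat" where
  "ecard A = (if finite A then enat (card A) else \<infinity>)"

text \<open>Linear independence over the integers in an abelian group written multiplicatively.\<close>

definition int_independent :: "('a, 'b) monoid_scheme \<Rightarrow> 'a set \<Rightarrow> bool" where
  "int_independent G S \<longleftrightarrow> finite S \<and> S \<subseteq> carrier G \<and>
     (\<forall>m :: 'a \<Rightarrow> int. finprod G (\<lambda>x. x [^]\<^bsub>G\<^esub> m x) S = \<one>\<^bsub>G\<^esub> \<longrightarrow> (\<forall>x\<in>S. m x = 0))"

definition abelian_rank :: "('a, 'b) monoid_scheme \<Rightarrow> enat" where
  "abelian_rank G = (SUP S \<in> {S. int_independent G S}. enat (card S))"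

definition betti_number :: "nat \<Rightarrow> 'a topology \<Rightarrow> enat" where
  "betti_number k X = abelian_rank (homology_group (int k) X)"

end

theory Submission
  imports Defs
begin

text \<open>
  The boundary of a convex body is homeomorphic to a sphere, so its Betti numbers add up to (at most)
  2, and two fixed points suffice. They are found at a maximum and a
  minimum of the thickness \<open>d\<close>. Since the boundary of \<open>C\<close> is C2, the outward rays foliate the
  complement of \<open>C\<close>, and a point \<open>y\<close> outside of \<open>C\<close> with nearest point \<open>q\<close> in \<open>C\<close> lies in \<open>\<Omega>\<close> iff
  \<open>dist y q < d q\<close>. At an extremum \<open>c\<close> of \<open>d\<close> the right-hand side is constant to first order, while the
  left-hand side has gradient \<open>\<nu> c\<close>; hence \<open>- \<nu> c\<close> is the inward normal of \<open>\<Omega>\<close> at \<open>c + d c *\<^sub>R \<nu> c\<close>,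
  and the half-line in this direction leads back to \<open>c\<close>.
\<close>

section \<open>Betti numbers of spheres\<close>

lemma int_independent_subset:
  fixes G (structure)
  assumes "comm_group G" "int_independent G S" "T \<subseteq> S"
  shows "int_independent G T"
proof -
  interpret comm_group G by fact
  have S: "finite S" "S \<subseteq> carrier G"
    and ind: "\<And>m :: 'a \<Rightarrow> int. finprod G (\<lambda>x. x [^] m x) S = \<one> \<Longrightarrow> \<forall>x\<in>S. m x = 0"
    using assms(2) by (auto simp: int_independent_def)
  show ?thesis
    unfolding int_independent_def
  proof (intro conjI allI impI)
    show "finite T" "T \<subseteq> carrier G"
      using S \<open>T \<subseteq> S\<close> finite_subset by auto
    fix m :: "'a \<Rightarrow> int"
    assume m: "(\<Otimes>x\<in>T. x [^] m x) = \<one>"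
    \<comment> \<open>A relation on \<open>T\<close> becomes one on \<open>S\<close> by giving
      exponent 0 to the remaining elements.\<close>
    have "(\<Otimes>x\<in>S. x [^] (if x \<in> T then m x else 0)) = (\<Otimes>x\<in>T. x [^] m x)"
      using S \<open>T \<subseteq> S\<close> by (intro finprod_mono_neutral_cong_right) auto
    then have "\<forall>x\<in>S. (if x \<in> T then m x else 0) = 0"
      using m by (intro ind) simp
    then show "\<forall>x\<in>T. m x = 0"
      using \<open>T \<subseteq> S\<close> by (metis subsetD)
  qed
qed

text \<open>Independence passes to subsets, so a larger independent set can be cut down to exactly
  \<open>Suc n\<close> elements; only this one cardinality has to be refuted.\<close>

lemma abelian_rank_leI:
  assumes "comm_group G"
    and "\<And>S. int_independent G S \<Longrightarrow> card S = Suc n \<Longrightarrow> False"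
  shows "abelian_rank G \<le> enat n"
  unfolding abelian_rank_def
proof (rule SUP_least, clarify)
  fix S assume S: "int_independent G S"
  show "enat (card S) \<le> enat n"
  proof (rule ccontr)
    assume "\<not> enat (card S) \<le> enat n"
    then obtain T where "T \<subseteq> S" "card T = Suc n"
      using obtain_subset_with_card_n[of "Suc n" S] by auto
    with int_independent_subset[OF assms(1) S] assms(2) show False by blast
  qed
qed

lemma abelian_rank_trivial_group:
  fixes G (structure)
  assumes "trivial_group G"
  shows "abelian_rank G = 0"
proof -
  have G: "comm_group G"
    using assms by (meson group.cyclic_imp_abelian_group trivial_group_def trivial_imp_cyclic_group)
  interpret comm_group G by fact
  have "abelian_rank G \<le> enat 0"
  proof (rule abelian_rank_leI[OF G])
    fix S assume S: "int_independent G S" "card S = Suc 0"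
    then have "finite S" "S \<subseteq> carrier G" by (auto simp: int_independent_def)
    then have "S \<subseteq> {\<one>}"
      using assms by (auto simp: trivial_group_def)
    then have "finprod G (\<lambda>x. x [^] (1::int)) S = \<one>"
      by (intro finprod_one_eqI) auto
    moreover have "finprod G (\<lambda>x. x [^] (1::int)) S = \<one> \<longrightarrow> (\<forall>x\<in>S. (1::int) = 0)"
      using S(1) unfolding int_independent_def by (elim conjE) (rule spec[where x = "\<lambda>_. 1"])
    ultimately have "S = {}"
      by auto
    with S show False by simp
  qed
  then show ?thesis by (simp flip: zero_enat_def)
qed

text \<open>Two integers a, b always satisfy b * a + (- a) * b = 0. Independence forces a = 0, and
  then the exponents 1, 0 give a forbidden relation.\<close>

lemma abelian_rank_integer_group:
  fixes G (structure)
  assumes "comm_group G" "G \<cong> integer_group"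
  shows "abelian_rank G \<le> 1"
proof -
  interpret comm_group G by fact
  obtain f where f: "f \<in> iso G integer_group"
    using assms(2) by (auto simp: is_iso_def)
  then have hom: "f \<in> hom G integer_group" and inj: "inj_on f (carrier G)"
    by (auto simp: iso_def bij_betw_def)
  have f1: "x = \<one>" if "x \<in> carrier G" "f x = 0" for x
    using inj that hom_one[OF hom] by (metis group_integer_group inj_onD is_group one_closed one_integer_group)
  have fpow: "f (x [^] (i::int)) = i * f x" if "x \<in> carrier G" for x i
    using hom_int_pow[OF hom that is_group] by simp
  have fmult: "f (x \<otimes> y) = f x + f y" if "x \<in> carrier G" "y \<in> carrier G" for x y
    using hom_mult[OF hom that] by simp
  have "abelian_rank G \<le> enat (Suc 0)"
  proof (rule abelian_rank_leI[OF assms(1)])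
    fix S assume S: "int_independent G S" "card S = Suc (Suc 0)"
    then obtain x y where xy: "S = {x, y}" "x \<noteq> y"
      using card_2_iff[of S] by (auto simp: numeral_2_eq_2)
    then have c: "x \<in> carrier G" "y \<in> carrier G"
      using S by (auto simp: int_independent_def)
    have ind: "p = 0 \<and> q = 0" if "p * f x + q * f y = 0" for p q
    proof -
      let ?m = "(\<lambda>_. 0)(x := p, y := q)"
      have "(\<Otimes>z\<in>S. z [^] ?m z) = \<one>"
        using xy c that by (intro f1) (auto simp: fpow fmult)
      then have "\<forall>z\<in>S. ?m z = 0"
        using S(1) unfolding int_independent_def by blast
      then show ?thesis using xy by auto
    qed
    from ind[of "f y" "- f x"] have "f x = 0" by simp
    with ind[of 1 0] show False by simp
  qed
  then show ?thesis by (simp add: one_enat_def)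
qed

text \<open>Three vectors of the integer plane are annihilated by the 2-by-2 minors of their coordinates.\<close>

lemma abelian_rank_integer_plane:
  fixes G (structure)
  assumes "comm_group G" "G \<cong> integer_group \<times>\<times> integer_group"
  shows "abelian_rank G \<le> 2"
proof -
  interpret comm_group G by fact
  let ?Z = "integer_group \<times>\<times> integer_group"
  have grp: "group ?Z" by (simp add: DirProd_group)
  obtain h where h: "h \<in> iso G ?Z"
    using assms(2) by (auto simp: is_iso_def)
  then have hom: "h \<in> hom G ?Z" and inj: "inj_on h (carrier G)"
    by (auto simp: iso_def bij_betw_def)
  define f where "f = (\<lambda>x. fst (h x))"
  define g where "g = (\<lambda>x. snd (h x))"
  have hf: "f \<in> hom G integer_group" and hg: "g \<in> hom G integer_group"
    using hom by (auto simp: hom_def f_def g_def DirProd_def case_prod_beta)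
  have fg1: "x = \<one>" if "x \<in> carrier G" "f x = 0" "g x = 0" for x
  proof -
    have "h \<one> = (0, 0)"
      using hom_one[OF hom is_group grp] by (simp add: DirProd_def)
    then have "h x = h \<one>"
      using that by (simp add: f_def g_def prod_eq_iff)
    then show ?thesis using inj that by (simp add: inj_on_eq_iff)
  qed
  have pow: "f (x [^] (i::int)) = i * f x" "g (x [^] (i::int)) = i * g x" if "x \<in> carrier G" for x i
    using hom_int_pow[OF hf that is_group] hom_int_pow[OF hg that is_group] by simp_all
  have mult: "f (x \<otimes> y) = f x + f y" "g (x \<otimes> y) = g x + g y" if "x \<in> carrier G" "y \<in> carrier G" for x y
    using hom_mult[OF hf that] hom_mult[OF hg that] by simp_all
  have "abelian_rank G \<le> enat (Suc (Suc 0))"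
  proof (rule abelian_rank_leI[OF assms(1)])
    fix S assume S: "int_independent G S" "card S = Suc (Suc (Suc 0))"
    then obtain x y z where xyz: "S = {x, y, z}" "x \<noteq> y" "x \<noteq> z" "y \<noteq> z"
      using card_3_iff[of S] by (auto simp: numeral_3_eq_3)
    then have c: "x \<in> carrier G" "y \<in> carrier G" "z \<in> carrier G"
      using S by (auto simp: int_independent_def)
    have ind: "p = 0 \<and> q = 0 \<and> r = 0"
      if "p * f x + q * f y + r * f z = 0" "p * g x + q * g y + r * g z = 0" for p q r
    proof -
      let ?m = "(\<lambda>_. 0)(x := p, y := q, z := r)"
      have "(\<Otimes>w\<in>S. w [^] ?m w) = \<one>"
        using xyz c that by (intro fg1) (auto simp: pow mult add.assoc)
      then have "\<forall>w\<in>S. ?m w = 0"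
        using S(1) unfolding int_independent_def by blast
      then show ?thesis using xyz by auto
    qed
    \<comment> \<open>The exponents form the cross product of \<open>(f x, f y, f z)\<close> and
      \<open>(g x, g y, g z)\<close>, which is orthogonal to both. Only the vanishing of its last
      entry is kept; it makes the two relations below, which involve just \<open>x\<close> and
      \<open>y\<close>, valid in both coordinates.\<close>
    have minor: "f x * g y - f y * g x = 0"
      using ind[of "f y * g z - f z * g y" "f z * g x - f x * g z" "f x * g y - f y * g x"]
      by (simp add: algebra_simps)
    have "f x = 0"
      using ind[of "f y" "- f x" 0] minor by (simp add: algebra_simps)
    moreover have "g x = 0"
      using ind[of "g y" "- g x" 0] minor by (simp add: algebra_simps)
    ultimately show False using ind[of 1 0 0] by simp
  qed
  then show ?thesis by (simp add: numeral_2_eq_2 flip: of_nat_eq_enat)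
qed

text \<open>The bound is written as a sum of two indicators because both fall on degree 0 when
  \<open>n = 0\<close>: the 0-sphere is a pair of points and its zeroth homology has rank 2.\<close>

lemma betti_number_sphere_le:
  fixes S :: "'b::euclidean_space set"
  assumes S: "S homeomorphic sphere (0::'a::euclidean_space) 1" and n: "DIM('a) = Suc n"
  shows "betti_number k (top_of_set S) \<le> (if k = 0 then 1 else 0) + (if k = n then 1 else 0)"
proof -
  let ?X = "top_of_set S"
  have ab: "comm_group (homology_group (int k) ?X)"
    by (rule abelian_homology_group)
  \<comment> \<open>\<open>nsphere\<close> lives in a space of coordinate sequences; the orthonormal
    basis \<open>Basis\<close> identifies it with the unit sphere of the Euclidean space.\<close>
  obtain f :: "(nat \<Rightarrow> real) \<Rightarrow> 'a" and g where
    "homeomorphic_maps (nsphere (DIM('a) - 1)) (top_of_set (sphere 0 1 \<inter> span Basis)) f g"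
    by (rule homeomorphic_maps_nsphere_euclidean_sphere[of "Basis :: 'a set" "DIM('a)"])
       (auto simp: independent_Basis orthogonal_Basis)
  then have "nsphere n homeomorphic_space top_of_set (sphere (0::'a) 1)"
    using n by (auto simp: homeomorphic_space_def)
  then have X: "?X homeomorphic_space nsphere n"
    using S homeomorphic_space_trans homeomorphic_space_sym homeomorphic_space_iff_homeomorphic by metis
  have iso: "homology_group (int k) ?X \<cong> homology_group (int k) (nsphere n)"
    using X by (rule homeomorphic_space_imp_isomorphic_homology_groups)
  consider "k \<noteq> 0" "k = n" | "k \<noteq> 0" "k \<noteq> n" | "k = 0" "n = 0" | "k = 0" "n \<noteq> 0" by blast
  then show ?thesis
  proof cases
    case 1
    then have "homology_group (int k) (nsphere n) = reduced_homology_group (int k) (nsphere n)"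
      by (simp add: un_reduced_homology_group)
    then have "homology_group (int k) ?X \<cong> integer_group"
      using iso reduced_homology_group_nsphere(1)[of n] 1 iso_trans by metis
    then show ?thesis
      using abelian_rank_integer_group[OF ab] 1 by (simp add: betti_number_def)
  next
    case 2
    then have "trivial_group (homology_group (int k) (nsphere n))"
      using reduced_homology_group_nsphere(2)[of "int k" n] by (simp add: un_reduced_homology_group)
    then show ?thesis
      using isomorphic_group_triviality[OF iso] abelian_rank_trivial_group 2
      by (simp add: betti_number_def)
  next
    case 3
    \<comment> \<open>The line \<open>?E\<close> is contractible, so the zeroth homology of the
      0-sphere splits into the integers and the first homology of the pair \<open>(?E, ?S)\<close>.
      The latter is isomorphic to the reduced zeroth homology of the 0-sphere, again the
      integers.\<close>
    let ?E = "Euclidean_space (Suc 0)" and ?S = "topspace (nsphere 0)"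
    have sub: "subtopology ?E ?S = nsphere 0"
      unfolding nsphere_def by (metis subtopology_restrict topspace_subtopology)
    have S: "?S \<subseteq> topspace ?E" "?S \<noteq> {}"
      using in_topspace_nsphere[of 0] by (auto simp: nsphere_def)
    have "relative_homology_group 1 ?E ?S \<cong> reduced_homology_group 0 (nsphere 0)"
      using isomorphic_group_relative_homology_of_contractible[of ?E ?S 1] S sub
      by (simp add: Int_absorb1)
    then have R: "relative_homology_group 1 ?E ?S \<cong> integer_group"
      using reduced_homology_group_nsphere(1)[of 0] by (auto intro: iso_trans)
    have "homology_group 0 (nsphere 0) \<cong> integer_group \<times>\<times> relative_homology_group 1 ?E ?S"
      using iso_homology_contractible_space_subtopology1[of ?E ?S] S sub by simp
    moreover have "integer_group \<times>\<times> relative_homology_group 1 ?E ?S \<cong> integer_group \<times>\<times> integer_group"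
      using R by (intro group.DirProd_iso_trans) (auto intro: iso_refl)
    ultimately have "homology_group (int k) ?X \<cong> integer_group \<times>\<times> integer_group"
      using iso 3 iso_trans by (metis of_nat_0)
    then show ?thesis
      using abelian_rank_integer_plane[OF ab] 3 by (simp add: betti_number_def)
  next
    case 4
    have "path_connected S"
      using path_connected_sphere[of "0::'a" 1] homeomorphic_path_connectedness[OF S] n 4 by simp
    moreover have "S \<noteq> {}"
      using homeomorphic_empty(2)[of "sphere (0::'a) 1"] S by (auto simp: homeomorphic_def homeomorphism_def)
    ultimately have "homology_group 0 ?X \<cong> integer_group"
      using path_connectedin_euclidean[of S] unfolding path_connectedin_def
      by (intro isomorphic_integer_zeroth_homology_group) auto
    then show ?thesis
      using abelian_rank_integer_group[OF ab] 4 by (simp add: betti_number_def)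
  qed
qed

section \<open>The boundary of a convex body as a sphere\<close>

lemma frontier_convex_homeomorphic_sphere:
  fixes C :: "'a::euclidean_space set"
  assumes "compact C" "convex C" "interior C \<noteq> {}"
  shows "frontier C homeomorphic sphere (0::'a) 1"
proof -
  have "rel_frontier C homeomorphic rel_frontier (cball (0::'a) 1)"
    using assms by (intro homeomorphic_rel_frontiers_convex_bounded_sets)
      (auto simp: compact_imp_bounded aff_dim_nonempty_interior)
  then show ?thesis
    using assms by (simp add: rel_frontier_nonempty_interior)
qed

lemma sum_betti_numbers_frontier_convex_le:
  fixes C :: "'a::euclidean_space set"
  assumes "compact C" "convex C" "interior C \<noteq> {}"
  shows "(\<Sum>k = 0..DIM('a) - 1. betti_number k (top_of_set (frontier C))) \<le> 2"
proof -
  obtain n where n: "DIM('a) = Suc n"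
    using DIM_positive[where 'a='a] by (metis Suc_pred')
  have "(\<Sum>k = 0..n. betti_number k (top_of_set (frontier C)))
      \<le> (\<Sum>k = 0..n. (if k = 0 then 1 else 0) + (if k = n then 1 else 0))"
    by (intro sum_mono betti_number_sphere_le[OF frontier_convex_homeomorphic_sphere n] assms)
  \<comment> \<open>Each indicator contributes 1, also for \<open>n = 0\<close>, where both sit in
    the single term.\<close>
  also have "\<dots> = (2::enat)"
    by (simp add: sum.distrib)
  finally show ?thesis by (simp add: n)
qed



section \<open>Extrema on hypersurfaces\<close>

text \<open>Small steps from \<open>u\<close> along \<open>H\<close> stay in \<open>V\<close>, so
  maximality gives \<open>D k \<le> 0\<close> for every \<open>k\<close> in \<open>H\<close>; this
  applies to \<open>h\<close> and to \<open>- h\<close>.\<close>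

lemma derivative_zero_at_relative_maximum:
  fixes g :: "'a::euclidean_space \<Rightarrow> real"
  assumes H: "subspace H" and V: "openin (top_of_set H) V" "u \<in> V"
    and D: "(g has_derivative D) (at u within V)"
    and max: "\<And>v. v \<in> V \<Longrightarrow> g v \<le> g u" and h: "h \<in> H"
  shows "D h = 0"
proof -
  have lin: "linear D"
    using D has_derivative_linear by blast
  have uH: "u \<in> H"
    using V openin_imp_subset by blast
  have le: "D k \<le> 0" if k: "k \<in> H" for k
  proof (rule field_le_epsilon)
    fix e :: real assume "e > 0"
    define e' where "e' = e / (norm k + 1)"
    have e': "e' > 0" "e' * norm k \<le> e"
      using \<open>e > 0\<close> by (auto simp: e'_def field_simps add_pos_nonneg)
    obtain d where d: "d > 0"
      "\<And>y. y \<in> V \<Longrightarrow> norm (y - u) < d \<Longrightarrow> norm (g y - g u - D (y - u)) \<le> e' * norm (y - u)"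
      using D e'(1) unfolding has_derivative_within_alt by blast
    obtain r where r: "r > 0" "\<And>x. x \<in> H \<Longrightarrow> dist x u < r \<Longrightarrow> x \<in> V"
      using V unfolding openin_euclidean_subtopology_iff by blast
    \<comment> \<open>This keeps \<open>t * norm k\<close> below both radii: \<open>r\<close> for
      staying in \<open>V\<close>, \<open>d\<close> for the first-order estimate. The added 1 covers
      \<open>k = 0\<close>.\<close>
    define t where "t = min d r / (norm k + 1)"
    have t: "t > 0"
      unfolding t_def using d(1) r(1) by (intro divide_pos_pos) (simp_all add: add_nonneg_pos)
    have "t * norm k < t * (norm k + 1)"
      using t by simp
    also have "\<dots> = min d r"
      by (simp add: t_def add_nonneg_pos less_imp_neq[symmetric])
    finally have tk: "t * norm k < d" "t * norm k < r" by auto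
    have "u + t *\<^sub>R k \<in> V"
      using r(2)[of "u + t *\<^sub>R k"] tk t k uH H by (simp add: dist_norm subspace_add subspace_scale)
    then have "\<bar>g (u + t *\<^sub>R k) - g u - t * D k\<bar> \<le> e' * (t * norm k)" "g (u + t *\<^sub>R k) \<le> g u"
      using d(2)[of "u + t *\<^sub>R k"] tk t max lin by (simp_all add: linear_scale)
    then have "t * D k \<le> e' * (t * norm k)"
      by linarith
    also have "\<dots> \<le> t * e"
      using e'(2) t by (simp add: mult.left_commute)
    finally show "D k \<le> 0 + e"
      using t by simp
  qed
  have "D (- h) = - D h"
    using lin by (rule linear_neg)
  with le[OF h] le[of "- h"] h H show ?thesis
    by (simp add: subspace_neg)
qed

lemma C2_param_has_derivative:
  assumes "C2_param S H V \<phi>" "u \<in> V"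
  obtains D where "(\<phi> has_derivative D) (at u within V)" "inj_on D H"
  using assms unfolding C2_param_def C2_on_def by blast

text \<open>
  An injective derivative makes the distance in \<open>S\<close> comparable with that in the parameter domain,
  so that the vanishing first-order term of \<open>f \<circ> \<phi>\<close> gives an estimate in terms of \<open>dist x c\<close>.
\<close>

lemma flat_at_extremum:
  assumes S: "C2_hypersurface S" "C2_function_on S f" and c: "c \<in> S"
    and ext: "(\<forall>x\<in>S. f x \<le> f c) \<or> (\<forall>x\<in>S. f c \<le> f x)" and "\<eta> > 0"
  shows "\<exists>\<delta>>0. \<forall>x\<in>S. dist x c < \<delta> \<longrightarrow> \<bar>f x - f c\<bar> \<le> \<eta> * dist x c"
proof -
  obtain H V \<phi> u where par: "C2_param S H V \<phi>" and u: "u \<in> V" "\<phi> u = c"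
    using S(1) c unfolding C2_hypersurface_def by (metis imageE)
  have H: "subspace H" and V: "openin (top_of_set H) V" and \<phi>V: "openin (top_of_set S) (\<phi> ` V)"
    using par unfolding C2_param_def by auto
  obtain \<psi> where \<psi>: "homeomorphism V (\<phi> ` V) \<phi> \<psi>"
    using par unfolding C2_param_def by auto
  obtain D where D: "(\<phi> has_derivative D) (at u within V)" "inj_on D H"
    using C2_param_has_derivative[OF par u(1)] .
  obtain G where G: "(f \<circ> \<phi> has_derivative G) (at u within V)"
    using S(2) par u(1) unfolding C2_function_on_def C2_on_def by blast
  have VH: "V \<subseteq> H" and VS: "\<phi> ` V \<subseteq> S"
    using V \<phi>V openin_imp_subset by blast+
  have G0: "G h = 0" if "h \<in> H" for h
    using ext
  proof
    assume "\<forall>x\<in>S. f x \<le> f c"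
    then show ?thesis
      using VS u by (intro derivative_zero_at_relative_maximum[OF H V u(1) G _ that]) auto
  next
    assume "\<forall>x\<in>S. f c \<le> f x"
    then have "- G h = 0"
      using VS u
      by (intro derivative_zero_at_relative_maximum[OF H V u(1) has_derivative_minus[OF G] _ that]) auto
    then show ?thesis by simp
  qed
  \<comment> \<open>Injectivity on the finite-dimensional space \<open>H\<close> yields a lower
    bound \<open>m\<close> for \<open>D\<close>. The remainder of \<phi> may consume half of it,
    leaving \<open>m / 2 * norm (y - u) \<le> dist x c\<close>; the tolerance
    \<open>\<eta> * (m / 2)\<close> for \<open>f \<circ> \<phi>\<close> then becomes
    \<open>\<eta> * dist x c\<close>.\<close>
  have "\<forall>x\<in>H. D x = 0 \<longrightarrow> x = 0"
    using D H by (metis has_derivative_linear inj_onD linear_0 subspace_0)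
  then obtain m where m: "m > 0" "\<And>h. h \<in> H \<Longrightarrow> m * norm h \<le> norm (D h)"
    using injective_imp_isometric[OF closed_subspace[OF H] H has_derivative_bounded_linear[OF D(1)]]
    by (auto simp: mult.commute)
  have m2: "m / 2 > 0" and \<eta>m: "\<eta> * (m / 2) > 0"
    using m(1) \<open>\<eta> > 0\<close> by auto
  obtain d1 where d1: "d1 > 0"
    "\<And>y. y \<in> V \<Longrightarrow> norm (y - u) < d1 \<Longrightarrow> norm (\<phi> y - \<phi> u - D (y - u)) \<le> m / 2 * norm (y - u)"
    using D(1) m2 unfolding has_derivative_within_alt by blast
  obtain d2 where d2: "d2 > 0"
    "\<And>y. y \<in> V \<Longrightarrow> norm (y - u) < d2 \<Longrightarrow>
       norm ((f \<circ> \<phi>) y - (f \<circ> \<phi>) u - G (y - u)) \<le> \<eta> * (m / 2) * norm (y - u)"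
    using G \<eta>m unfolding has_derivative_within_alt by blast
  have "continuous_on (\<phi> ` V) \<psi>" and \<psi>c: "\<psi> c = u"
    using \<psi> u by (auto simp: homeomorphism_def)
  then obtain d3 where d3: "d3 > 0"
    "\<And>x. x \<in> \<phi> ` V \<Longrightarrow> dist x c < d3 \<Longrightarrow> dist (\<psi> x) u < min d1 d2"
    using u d1(1) d2(1) unfolding continuous_on_iff by (metis imageI min_less_iff_conj)
  obtain d4 where d4: "d4 > 0" "\<And>x. x \<in> S \<Longrightarrow> dist x c < d4 \<Longrightarrow> x \<in> \<phi> ` V"
    using \<phi>V u unfolding openin_euclidean_subtopology_iff by (metis imageI)
  show ?thesis
  proof (intro exI[of _ "min d3 d4"] conjI ballI impI)
    show "min d3 d4 > 0" using d3 d4 by simp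
    fix x assume x: "x \<in> S" "dist x c < min d3 d4"
    then have xV: "x \<in> \<phi> ` V" using d4 by simp
    define y where "y = \<psi> x"
    have y: "y \<in> V" "\<phi> y = x" "norm (y - u) < d1" "norm (y - u) < d2"
      using xV \<psi> d3(2)[OF xV] x by (auto simp: homeomorphism_def y_def dist_norm)
    have yu: "y - u \<in> H"
      using y u VH H by (auto intro: subspace_diff)
    have "m * norm (y - u) \<le> norm (D (y - u))"
      using m(2)[OF yu] .
    also have "\<dots> \<le> norm (\<phi> y - \<phi> u) + m / 2 * norm (y - u)"
      using d1(2)[OF y(1,3)] norm_triangle_sub[of "D (y - u)" "\<phi> y - \<phi> u"]
      by (simp add: norm_minus_commute)
    finally have *: "m / 2 * norm (y - u) \<le> dist x c"
      using y u by (simp add: dist_norm)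
    have "\<bar>f x - f c\<bar> \<le> \<eta> * (m / 2 * norm (y - u))"
      using d2(2)[OF y(1,4)] G0[OF yu] y u by (simp add: mult.assoc)
    also have "\<dots> \<le> \<eta> * dist x c"
      using * \<open>\<eta> > 0\<close> by (intro mult_left_mono) auto
    finally show "\<bar>f x - f c\<bar> \<le> \<eta> * dist x c" .
  qed
qed

text \<open>On the image of a chart, \<open>f\<close> is \<open>f \<circ> \<phi>\<close> composed
  with the continuous inverse of the chart; such an image is open in \<open>S\<close>, so continuity
  there is continuity within \<open>S\<close>.\<close>

lemma continuous_on_C2_function:
  assumes S: "C2_hypersurface S" "C2_function_on S f"
  shows "continuous_on S f"
  unfolding continuous_on_eq_continuous_within
proof
  fix c assume "c \<in> S"
  then obtain H V \<phi> u where par: "C2_param S H V \<phi>" and u: "u \<in> V" "\<phi> u = c"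
    using S(1) unfolding C2_hypersurface_def by (metis imageE)
  have \<phi>V: "openin (top_of_set S) (\<phi> ` V)"
    using par unfolding C2_param_def by auto
  obtain \<psi> where \<psi>: "homeomorphism V (\<phi> ` V) \<phi> \<psi>"
    using par unfolding C2_param_def by auto
  have "continuous_on V (f \<circ> \<phi>)"
    using S(2) par unfolding C2_function_on_def C2_on_def
    by (meson continuous_on_eq_continuous_within has_derivative_continuous)
  then have "continuous_on (\<phi> ` V) ((f \<circ> \<phi>) \<circ> \<psi>)"
    using homeomorphism_cont2[OF \<psi>] homeomorphism_image2[OF \<psi>] by (metis continuous_on_compose)
  then have "continuous_on (\<phi> ` V) f"
    by (rule continuous_on_eq) (simp add: homeomorphism_apply2[OF \<psi>])
  then have "continuous (at c within \<phi> ` V) f"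
    using u by (auto simp: continuous_on_eq_continuous_within)
  moreover obtain T where T: "open T" "\<phi> ` V = S \<inter> T"
    using \<phi>V by (auto simp: openin_open)
  moreover have "at c within S \<inter> T = at c within S"
    using T u by (intro at_within_nhd[of c T]) auto
  ultimately show "continuous (at c within S) f"
    by simp
qed

section \<open>Normals\<close>

text \<open>If the component of \<open>b\<close> orthogonal to \<open>a\<close> were nonzero, it
  would span with \<open>a\<close> a plane orthogonal to \<open>W\<close>, too large for the ambient
  dimension.\<close>

lemma unit_normals_of_hyperplane:
  fixes a b :: "'a::euclidean_space"
  assumes "norm a = 1" "norm b = 1" and orth: "\<And>w. w \<in> W \<Longrightarrow> w \<bullet> a = 0" "\<And>w. w \<in> W \<Longrightarrow> w \<bullet> b = 0"
    and dim: "dim W + 1 = DIM('a)"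
  shows "a = b \<or> a = - b"
proof -
  define b' where "b' = b - (a \<bullet> b) *\<^sub>R a"
  have ab': "a \<bullet> b' = 0"
    using assms(1) by (simp add: b'_def inner_diff_right dot_square_norm)
  have "b' = 0"
  proof (rule ccontr)
    assume "b' \<noteq> 0"
    moreover have "a \<noteq> 0" using assms(1) by auto
    ultimately have "independent {a, b'}"
      using ab' by (intro pairwise_orthogonal_independent)
        (auto simp: pairwise_def orthogonal_def inner_commute)
    moreover have "a \<noteq> b'" using ab' \<open>b' \<noteq> 0\<close> by auto
    ultimately have "dim {a, b'} = 2"
      by (simp add: dim_eq_card_independent)
    moreover have "dim (W \<union> {a, b'}) = dim W + dim {a, b'}"
    proof (rule dim_orthogonal_sum)
      fix x y assume "x \<in> W" "y \<in> {a, b'}"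
      then show "x \<bullet> y = 0"
        using orth by (auto simp: b'_def inner_diff_right)
    qed
    ultimately show False
      using dim dim_subset_UNIV[of "W \<union> {a, b'}"] by simp
  qed
  then have b: "b = (a \<bullet> b) *\<^sub>R a"
    by (simp add: b'_def)
  then have "\<bar>a \<bullet> b\<bar> = 1"
    using assms by (metis mult.right_neutral norm_scaleR)
  then show ?thesis
    using b by (metis abs_1 abs_eq_iff minus_minus scaleR_minus1_left scaleR_one)
qed

text \<open>A small step from \<open>x\<close> in direction \<open>n - m\<close> would be inside
  \<open>S\<close> by the cone condition for \<open>n\<close> and outside by that for
  \<open>m\<close>.\<close>

lemma has_inward_normal_unique:
  assumes "has_inward_normal S x n" "has_inward_normal S x m"
  shows "n = m"
proof (rule ccontr)
  assume "n \<noteq> m"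
  define w where "w = n - m"
  have w: "norm w > 0" using \<open>n \<noteq> m\<close> by (simp add: w_def)
  have nm: "norm n = 1" "norm m = 1"
    using assms by (auto simp: has_inward_normal_def)
  then have nm1: "n \<bullet> n = 1" "m \<bullet> m = 1" "m \<bullet> n = n \<bullet> m"
    by (simp_all add: dot_square_norm inner_commute)
  have "(norm w)\<^sup>2 = 2 * (1 - n \<bullet> m)"
    by (simp add: w_def power2_norm_eq_inner inner_diff nm1)
  then have wn: "w \<bullet> n = (norm w)\<^sup>2 / 2" "w \<bullet> m = - (norm w)\<^sup>2 / 2"
    by (simp_all add: w_def inner_diff nm1)
  \<comment> \<open>The unit vector along \<open>w\<close> has inner products
    \<open>norm w / 2\<close> and \<open>- norm w / 2\<close> with \<open>n\<close> and
    \<open>m\<close>; half of this as cone width keeps both inequalities strict.\<close>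
  have e: "norm w / 4 > 0" using w by simp
  obtain d1 where d1: "d1 > 0"
    "\<And>y. dist y x < d1 \<Longrightarrow> (y - x) \<bullet> n > norm w / 4 * norm (y - x) \<Longrightarrow> y \<in> S"
    using assms(1) e unfolding has_inward_normal_def by blast
  obtain d2 where d2: "d2 > 0"
    "\<And>y. dist y x < d2 \<Longrightarrow> (y - x) \<bullet> m < - (norm w / 4) * norm (y - x) \<Longrightarrow> y \<notin> S"
    using assms(2) e unfolding has_inward_normal_def by blast
  define t where "t = min d1 d2 / (2 * norm w)"
  have t: "t > 0" "t * norm w < d1" "t * norm w < d2"
    using d1(1) d2(1) w by (auto simp: t_def)
  let ?y = "x + t *\<^sub>R w"
  have tw: "t * (norm w)\<^sup>2 > 0" using t w by simp
  have "?y \<in> S"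
    using d1(2)[of ?y] t w wn tw by (simp add: dist_norm power2_eq_square)
  moreover have "?y \<notin> S"
    using d2(2)[of ?y] t w wn tw by (simp add: dist_norm power2_eq_square)
  ultimately show False by simp
qed

lemma inward_normal_eq:
  assumes "has_inward_normal S x n"
  shows "inward_normal S x = n"
  unfolding inward_normal_def using assms has_inward_normal_unique by blast

text \<open>These are the unit vectors of the normal cone of convex geometry. They link supporting
  hyperplanes, nearest points and \<open>outward_normal\<close>.\<close>

definition unit_support :: "'a::euclidean_space set \<Rightarrow> 'a \<Rightarrow> 'a \<Rightarrow> bool" where
  "unit_support C p a \<longleftrightarrow> norm a = 1 \<and> (\<forall>y\<in>C. (y - p) \<bullet> a \<le> 0)"

text \<open>
  Points outside of \<open>C\<close> that contradict the inner cone condition have nearest-point directions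
  which accumulate at a second supporting normal.
\<close>

lemma has_inward_normal_unique_support:
  fixes C :: "'a::euclidean_space set"
  assumes C: "closed C" "convex C" and p: "p \<in> frontier C"
    and a: "unit_support C p a" and uniq: "\<And>b. unit_support C p b \<Longrightarrow> b = a"
  shows "has_inward_normal C p (- a)"
  unfolding has_inward_normal_def
proof (intro conjI allI impI)
  show "p \<in> frontier C" by fact
  have na: "norm a = 1" and sup: "\<And>y. y \<in> C \<Longrightarrow> (y - p) \<bullet> a \<le> 0"
    using a by (auto simp: unit_support_def)
  show "norm (- a) = 1" using na by simp
  have pC: "p \<in> C" using p C by (simp add: frontier_def)
  fix \<epsilon> :: real assume \<epsilon>: "\<epsilon> > 0"
  have outside: "y \<notin> C" if "(y - p) \<bullet> - a < - \<epsilon> * norm (y - p)" for y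
  proof
    assume "y \<in> C"
    then have "(y - p) \<bullet> - a \<ge> 0" using sup by simp
    moreover have "\<epsilon> * norm (y - p) \<ge> 0" using \<epsilon> by simp
    ultimately show False using that by simp
  qed
  have "\<exists>\<delta>>0. \<forall>y. dist y p < \<delta> \<longrightarrow> (y - p) \<bullet> - a > \<epsilon> * norm (y - p) \<longrightarrow> y \<in> C"
  proof (rule ccontr)
    assume "\<not> ?thesis"
    then have "\<forall>n. \<exists>y. dist y p < inverse (real (Suc n)) \<and> (y - p) \<bullet> - a > \<epsilon> * norm (y - p) \<and> y \<notin> C"
      by (meson inverse_positive_iff_positive of_nat_0_less_iff zero_less_Suc)
    then obtain y where y: "\<And>n. dist (y n) p < inverse (real (Suc n))"
      "\<And>n. (y n - p) \<bullet> - a > \<epsilon> * norm (y n - p)" "\<And>n. y n \<notin> C"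
      by metis
    have "(\<lambda>n. dist (y n) p) \<longlonglongrightarrow> 0"
      using y(1) by (intro real_tendsto_sandwich[OF _ _ tendsto_const LIMSEQ_inverse_real_of_nat])
        (auto intro: always_eventually less_imp_le)
    then have yp: "y \<longlonglongrightarrow> p"
      by (rule tendsto_dist_iff[THEN iffD2])
    define q where "q = (\<lambda>n. closest_point C (y n))"
    have "isCont (closest_point C) p"
      using C pC by (intro continuous_at_closest_point) auto
    then have "(\<lambda>n. closest_point C (y n)) \<longlonglongrightarrow> closest_point C p"
      using yp isCont_tendsto_compose by blast
    then have qp: "q \<longlonglongrightarrow> p"
      using pC by (simp add: q_def closest_point_self)
    have qC: "q n \<in> C" for n
      using C pC by (auto simp: q_def intro: closest_point_in_set)
    have yq: "y n \<noteq> q n" and yp': "y n \<noteq> p" for n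
      using y(3) qC pC by metis+
    \<comment> \<open>Unit directions to \<open>y n\<close> from its nearest point and from
      \<open>p\<close>. Compactness of the product of spheres gives a common subsequence, with
      limits \<open>b\<close> and \<open>v\<close>.\<close>
    define z where "z = (\<lambda>n. sgn (y n - q n))"
    define w where "w = (\<lambda>n. sgn (y n - p))"
    have zw: "(z n, w n) \<in> sphere 0 1 \<times> sphere 0 1" for n
      using yq[of n] yp'[of n] by (simp add: z_def w_def norm_sgn)
    have "compact (sphere (0::'a) 1 \<times> sphere (0::'a) 1)"
      by (intro compact_Times) auto
    then have "seq_compact (sphere (0::'a) 1 \<times> sphere (0::'a) 1)"
      by (rule compact_imp_seq_compact)
    then obtain l r where l: "l \<in> sphere (0::'a) 1 \<times> sphere (0::'a) 1" "strict_mono r"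
      "((\<lambda>n. (z n, w n)) \<circ> r) \<longlonglongrightarrow> l"
      by (rule seq_compactE[of _ "\<lambda>n. (z n, w n)"]) (use zw in blast)+
    obtain b v where bv: "l = (b, v)" by fastforce
    have zb: "(\<lambda>n. z (r n)) \<longlonglongrightarrow> b" and wv: "(\<lambda>n. w (r n)) \<longlonglongrightarrow> v"
      using tendsto_fst[OF l(3)] tendsto_snd[OF l(3)] bv by (simp_all add: o_def)
    have qr: "(\<lambda>n. q (r n)) \<longlonglongrightarrow> p"
      using LIMSEQ_subseq_LIMSEQ[OF qp l(2)] by (simp add: o_def)
    have zq: "(x - q n) \<bullet> z n \<le> 0" if "x \<in> C" for x n
    proof -
      have "(y n - q n) \<bullet> (x - q n) \<le> 0"
        using closest_point_dot[OF C(2,1) that] by (simp add: q_def)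
      then show ?thesis
        by (simp add: z_def sgn_div_norm inner_commute divide_nonpos_nonneg mult_nonneg_nonpos)
    qed
    \<comment> \<open>Each \<open>z n\<close> supports \<open>C\<close> at \<open>q n\<close>; along
      the subsequence this passes to the limit point \<open>p\<close>.\<close>
    have "unit_support C p b"
      unfolding unit_support_def
    proof (intro conjI ballI)
      show "norm b = 1" using l(1) bv by simp
      fix x assume "x \<in> C"
      have "(\<lambda>n. (x - q (r n)) \<bullet> z (r n)) \<longlonglongrightarrow> (x - p) \<bullet> b"
        by (intro tendsto_intros qr zb)
      then show "(x - p) \<bullet> b \<le> 0"
        by (rule LIMSEQ_le_const2) (use zq[OF \<open>x \<in> C\<close>] in auto)
    qed
    then have "b = a" by (rule uniq)
    \<comment> \<open>The point \<open>p\<close> of \<open>C\<close> lies behind the supporting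
      hyperplane at \<open>q n\<close>, and \<open>y n\<close> in front of it. In the limit
      \<open>v \<bullet> a \<ge> 0\<close>, whereas the violated cone condition gives
      \<open>v \<bullet> a \<le> - \<epsilon>\<close>.\<close>
    have "w n \<bullet> z n \<ge> 0" for n
    proof -
      have "(y n - q n) \<bullet> z n \<ge> 0"
        by (simp add: z_def sgn_div_norm)
      with zq[OF pC, of n] have "(y n - p) \<bullet> z n \<ge> 0"
        by (simp add: inner_diff_left)
      then show ?thesis by (simp add: w_def sgn_div_norm)
    qed
    moreover have "(\<lambda>n. w (r n) \<bullet> z (r n)) \<longlonglongrightarrow> v \<bullet> b"
      by (intro tendsto_intros wv zb)
    ultimately have "v \<bullet> a \<ge> 0"
      unfolding \<open>b = a\<close> by (intro LIMSEQ_le_const) auto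
    have "w n \<bullet> a \<le> - \<epsilon>" for n
    proof -
      have "(y n - p) \<bullet> a / norm (y n - p) \<le> - \<epsilon>"
        using y(2)[of n] yp'[of n] by (simp add: pos_divide_le_eq)
      then show ?thesis by (simp add: w_def sgn_div_norm divide_inverse_commute)
    qed
    moreover have "(\<lambda>n. w (r n) \<bullet> a) \<longlonglongrightarrow> v \<bullet> a"
      by (intro tendsto_intros wv)
    ultimately have "v \<bullet> a \<le> - \<epsilon>"
      by (intro LIMSEQ_le_const2) auto
    with \<open>v \<bullet> a \<ge> 0\<close> \<epsilon> show False by simp
  qed
  then obtain \<delta> where \<delta>: "\<delta> > 0"
    "\<And>y. dist y p < \<delta> \<Longrightarrow> (y - p) \<bullet> - a > \<epsilon> * norm (y - p) \<Longrightarrow> y \<in> C"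
    by blast
  show "\<exists>\<delta>>0. \<forall>y. dist y p < \<delta> \<longrightarrow>
        ((y - p) \<bullet> - a > \<epsilon> * norm (y - p) \<longrightarrow> y \<in> C) \<and>
        ((y - p) \<bullet> - a < - \<epsilon> * norm (y - p) \<longrightarrow> y \<notin> C)"
    using \<delta> outside by blast
qed

section \<open>Nearest points and outward rays of a convex body with C2 boundary\<close>

locale smooth_convex_body =
  fixes C :: "'a::euclidean_space set"
  assumes compact: "compact C" and convex: "convex C" and interior: "interior C \<noteq> {}"
    and smooth: "C2_hypersurface (frontier C)"
begin

lemma closed: "closed C"
  using compact by (rule compact_imp_closed)

lemma frontier_subset: "frontier C \<subseteq> C"
  using closed by (rule frontier_subset_closed)

lemma unit_support_unique:
  assumes p: "p \<in> frontier C" and a: "unit_support C p a" and b: "unit_support C p b"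
  shows "a = b"
proof -
  obtain H V \<phi> u where par: "C2_param (frontier C) H V \<phi>" and u: "u \<in> V" "\<phi> u = p"
    using smooth p unfolding C2_hypersurface_def by (metis imageE)
  have H: "subspace H" "dim H + 1 = DIM('a)" and V: "openin (top_of_set H) V"
    and "openin (top_of_set (frontier C)) (\<phi> ` V)"
    using par unfolding C2_param_def by auto
  then have VC: "\<phi> ` V \<subseteq> C"
    using openin_imp_subset frontier_subset by blast
  obtain D where D: "(\<phi> has_derivative D) (at u within V)" "inj_on D H"
    using C2_param_has_derivative[OF par u(1)] .
  have orth: "w \<bullet> n = 0" if "unit_support C p n" "w \<in> D ` H" for n w
  proof -
    obtain h where h: "h \<in> H" "w = D h" using \<open>w \<in> D ` H\<close> by blast
    have "\<phi> v \<bullet> n \<le> \<phi> u \<bullet> n" if "v \<in> V" for v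
      using \<open>unit_support C p n\<close> VC that u by (force simp: unit_support_def inner_diff_left)
    from derivative_zero_at_relative_maximum[OF H(1) V u(1) has_derivative_inner_left[OF D(1)] this h(1)]
    show ?thesis by (simp add: h)
  qed
  have "dim (D ` H) = dim H"
    using dim_image_eq[OF has_derivative_linear[OF D(1)]] D(2) span_eq_iff[THEN iffD2, OF H(1)]
    by metis
  then have "a = b \<or> a = - b"
    using orth a b H(2)
    by (intro unit_normals_of_hyperplane[where W = "D ` H"]) (auto simp: unit_support_def)
  moreover have "a \<noteq> - b"
  proof
    assume ab: "a = - b"
    have flat: "(y - p) \<bullet> b = 0" if "y \<in> C" for y
      using a b that by (force simp: unit_support_def ab intro: antisym)
    obtain z e where e: "e > 0" "cball z e \<subseteq> C"
      using interior by (metis equals0I mem_interior_cball)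
    have nb: "norm b = 1" using b by (simp add: unit_support_def)
    have "z + e *\<^sub>R b \<in> C" "z \<in> C"
      using e nb by (auto intro!: subsetD[OF e(2)] simp: dist_norm)
    from this[THEN flat] have "e * (b \<bullet> b) = 0"
      by (simp add: inner_diff_left inner_add_left)
    then show False using e nb by auto
  qed
  ultimately show ?thesis by blast
qed

lemma unit_support_exists:
  assumes "p \<in> frontier C"
  shows "\<exists>a. unit_support C p a"
proof -
  have "p \<in> closure C" "p \<notin> rel_interior C"
    using assms interior by (auto simp: frontier_def rel_interior_nonempty_interior)
  then obtain a where a: "a \<noteq> 0" "\<And>y. y \<in> closure C \<Longrightarrow> a \<bullet> p \<le> a \<bullet> y"
    using supporting_hyperplane_relative_frontier[OF convex] by metis
  \<comment> \<open>The supporting vector \<open>a\<close> satisfies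
    \<open>a \<bullet> p \<le> a \<bullet> y\<close> on \<open>C\<close>, so it points inwards and
    the sign is reversed.\<close>
  have "unit_support C p (- sgn a)"
    unfolding unit_support_def
  proof (intro conjI ballI)
    show "norm (- sgn a) = 1" using a(1) by (simp add: norm_sgn)
    fix y assume "y \<in> C"
    then have "a \<bullet> (y - p) \<ge> 0"
      using a(2)[of y] closure_subset by (auto simp: inner_diff_right)
    then show "(y - p) \<bullet> - sgn a \<le> 0"
      by (simp add: sgn_div_norm inner_commute)
  qed
  then show ?thesis ..
qed

text \<open>This resolves the definite description behind \<open>outward_normal\<close>: a
  supporting vector exists, is the only one, and hence satisfies the two-sided cone
  condition.\<close>

lemma outward_normal_unit_support:
  assumes "p \<in> frontier C"
  shows "unit_support C p (outward_normal C p)"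
proof -
  obtain a where a: "unit_support C p a"
    using unit_support_exists[OF assms] ..
  then have "has_inward_normal C p (- a)"
    using has_inward_normal_unique_support[OF closed convex assms] unit_support_unique[OF assms] by blast
  then have "outward_normal C p = a"
    by (simp add: outward_normal_def inward_normal_eq)
  with a show ?thesis by simp
qed

lemma norm_outward_normal: "p \<in> frontier C \<Longrightarrow> norm (outward_normal C p) = 1"
  using outward_normal_unit_support by (simp add: unit_support_def)

lemma inner_outward_normal_le:
  "p \<in> frontier C \<Longrightarrow> y \<in> C \<Longrightarrow> (y - p) \<bullet> outward_normal C p \<le> 0"
  using outward_normal_unit_support by (simp add: unit_support_def)

text \<open>All of \<open>C\<close> lies behind the supporting hyperplane at \<open>c\<close>, so a
  point at height \<open>r\<close> above \<open>c\<close> is at distance at least \<open>r\<close>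
  from \<open>C\<close>.\<close>

lemma closest_point_outward_ray:
  assumes c: "c \<in> frontier C" and "r \<ge> 0"
  shows "closest_point C (c + r *\<^sub>R outward_normal C c) = c"
proof (rule closest_point_unique[OF convex closed, symmetric])
  let ?\<nu> = "outward_normal C c"
  show "c \<in> C" using c frontier_subset by blast
  show "\<forall>z\<in>C. dist (c + r *\<^sub>R ?\<nu>) c \<le> dist (c + r *\<^sub>R ?\<nu>) z"
  proof
    fix z assume "z \<in> C"
    have \<nu>: "norm ?\<nu> = 1" using norm_outward_normal[OF c] .
    have "r \<le> r * (?\<nu> \<bullet> ?\<nu>) - (z - c) \<bullet> ?\<nu>"
      using inner_outward_normal_le[OF c \<open>z \<in> C\<close>] \<nu> by (simp add: dot_square_norm)
    also have "\<dots> = (c + r *\<^sub>R ?\<nu> - z) \<bullet> ?\<nu>"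
      by (simp add: algebra_simps)
    also have "\<dots> \<le> norm (c + r *\<^sub>R ?\<nu> - z)"
      using norm_cauchy_schwarz[of "c + r *\<^sub>R ?\<nu> - z" ?\<nu>] \<nu> by simp
    finally show "dist (c + r *\<^sub>R ?\<nu>) c \<le> dist (c + r *\<^sub>R ?\<nu>) z"
      using \<nu> \<open>r \<ge> 0\<close> by (simp add: dist_norm)
  qed
qed

lemma closest_point_in_frontier:
  assumes "y \<notin> C"
  shows "closest_point C y \<in> frontier C"
proof -
  have "affine hull C = UNIV" "rel_frontier C = frontier C" "C \<noteq> {}" "y \<notin> rel_interior C"
    using interior rel_interior_subset assms
    by (auto simp: affine_hull_nonempty_interior rel_frontier_nonempty_interior)
  then show ?thesis
    using closest_point_in_rel_frontier[OF closed, of y] by simp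
qed

text \<open>The obtuse angle property of the projection makes \<open>y - q\<close> a supporting
  direction at \<open>q\<close>, and uniqueness identifies it with the outward normal.\<close>

lemma closest_point_decomposition:
  assumes y: "y \<notin> C"
  defines "q \<equiv> closest_point C y"
  shows "y = q + dist y q *\<^sub>R outward_normal C q"
proof -
  have q: "q \<in> frontier C"
    using closest_point_in_frontier[OF y] by (simp add: q_def)
  then have "q \<in> C" using frontier_subset by blast
  then have yq: "norm (y - q) > 0" using y by auto
  have "unit_support C q (sgn (y - q))"
    unfolding unit_support_def
  proof (intro conjI ballI)
    show "norm (sgn (y - q)) = 1" using yq by (simp add: norm_sgn)
    fix x assume "x \<in> C"
    then have "(y - q) \<bullet> (x - q) \<le> 0"
      using closest_point_dot[OF convex closed] by (simp add: q_def)
    then show "(x - q) \<bullet> sgn (y - q) \<le> 0"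
      by (simp add: sgn_div_norm inner_commute mult_nonneg_nonpos divide_nonpos_nonneg)
  qed
  then have "outward_normal C q = sgn (y - q)"
    using unit_support_unique[OF q] outward_normal_unit_support[OF q] by blast
  then show ?thesis
    using yq by (simp add: sgn_div_norm dist_norm)
qed

end

section \<open>Fixed points of the return map\<close>

locale radial_domain = smooth_convex_body +
  fixes \<Omega>
  assumes op: "open \<Omega>" and bdd: "bounded \<Omega>" and subset: "C \<subseteq> \<Omega>"
    and radial: "radial_map C \<Omega> ` frontier C = frontier \<Omega> - C"
begin

abbreviation "\<nu> \<equiv> outward_normal C"
abbreviation "d \<equiv> thickness C \<Omega>"

lemma bdd_above_outward_ray:
  assumes c: "c \<in> frontier C"
  shows "bdd_above {r. r \<ge> 0 \<and> c + r *\<^sub>R \<nu> c \<in> \<Omega>}"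
proof -
  obtain B where B: "\<And>x. x \<in> \<Omega> \<Longrightarrow> norm x \<le> B"
    using bdd by (auto simp: bounded_iff)
  have "r \<le> B + norm c" if "r \<ge> 0" "c + r *\<^sub>R \<nu> c \<in> \<Omega>" for r
  proof -
    have "r = norm (r *\<^sub>R \<nu> c)" using that norm_outward_normal[OF c] by simp
    also have "\<dots> \<le> norm (c + r *\<^sub>R \<nu> c) + norm c"
      using norm_triangle_ineq4[of "c + r *\<^sub>R \<nu> c" c] by simp
    also have "\<dots> \<le> B + norm c" using B[OF that(2)] by simp
    finally show ?thesis .
  qed
  then show ?thesis unfolding bdd_above_def by blast
qed

lemma le_thickness:
  assumes "c \<in> frontier C" "r \<ge> 0" "c + r *\<^sub>R \<nu> c \<in> \<Omega>"
  shows "r \<le> d c"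
  unfolding thickness_def using assms bdd_above_outward_ray by (auto intro: cSup_upper)

lemma thickness_nonneg: "c \<in> frontier C \<Longrightarrow> d c \<ge> 0"
  using le_thickness[of c 0] frontier_subset subset by auto

text \<open>The ray can meet the frontier of \<Omega> only at parameter \<open>d c\<close>: such a
  point is the radial image of some \<open>c'\<close>, and projecting to \<open>C\<close> gives
  \<open>c' = c\<close>. Hence the ray cannot leave \<Omega> and come back earlier.\<close>

lemma outward_ray_mem_iff:
  assumes c: "c \<in> frontier C" and r: "r \<ge> 0"
  shows "c + r *\<^sub>R \<nu> c \<in> \<Omega> \<longleftrightarrow> r < d c"
proof -
  let ?A = "{r. r \<ge> 0 \<and> c + r *\<^sub>R \<nu> c \<in> \<Omega>}"
  have n\<nu>: "norm (\<nu> c) = 1" using norm_outward_normal[OF c] .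
  have up: "r \<le> d c" if "r \<in> ?A" for r
    using le_thickness[OF c] that by simp
  have "0 \<in> ?A" using c frontier_subset subset by auto
  then have ne: "?A \<noteq> {}" by blast
  have rad: "radial_map C \<Omega> c \<notin> \<Omega>"
    using radial c op by (metis DiffE Int_iff disjoint_iff frontier_disjoint_eq image_eqI)
  have front: "r = d c" if rr: "r \<ge> 0" "c + r *\<^sub>R \<nu> c \<in> frontier \<Omega>" for r
  proof -
    have "c + r *\<^sub>R \<nu> c \<notin> C"
      using rr(2) op subset by (metis disjoint_iff frontier_disjoint_eq subsetD)
    then obtain c' where c': "c' \<in> frontier C" "c + r *\<^sub>R \<nu> c = c' + d c' *\<^sub>R \<nu> c'"
      using rr(2) radial unfolding radial_map_def by blast
    have "c = c'"
      using thickness_nonneg[OF c'(1)] closest_point_outward_ray[OF c rr(1)]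
        closest_point_outward_ray[OF c'(1)] c'(2)
      by metis
    then show ?thesis using c'(2) n\<nu> by auto
  qed
  show ?thesis
  proof
    assume "c + r *\<^sub>R \<nu> c \<in> \<Omega>"
    then have "r \<le> d c" using up r by simp
    moreover have "r \<noteq> d c"
      using rad \<open>c + r *\<^sub>R \<nu> c \<in> \<Omega>\<close> by (auto simp: radial_map_def)
    ultimately show "r < d c" by simp
  next
    assume "r < d c"
    then obtain s where s: "s \<in> ?A" "r < s"
      using less_cSup_iff[OF ne bdd_above_outward_ray[OF c]] unfolding thickness_def by blast
    show "c + r *\<^sub>R \<nu> c \<in> \<Omega>"
    proof (rule ccontr)
      assume out: "c + r *\<^sub>R \<nu> c \<notin> \<Omega>"
      \<comment> \<open>The segment from parameter \<open>r\<close> to \<open>s\<close> would cross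
        the frontier, necessarily at \<open>d c\<close>. As \<open>s\<close> is at most
        \<open>d c\<close>, it would equal \<open>d c\<close>, but the radial point is not in the
        open set \<Omega>.\<close>
      let ?I = "(\<lambda>t. c + t *\<^sub>R \<nu> c) ` {r..s}"
      have "connected ?I"
        by (intro connected_continuous_image continuous_intros) auto
      moreover have "c + s *\<^sub>R \<nu> c \<in> ?I \<inter> \<Omega>" "c + r *\<^sub>R \<nu> c \<in> ?I - \<Omega>"
        using s out by auto
      ultimately obtain x where "x \<in> ?I" "x \<in> frontier \<Omega>"
        using connected_Int_frontier[of ?I \<Omega>] by blast
      then obtain t where t: "r \<le> t" "t \<le> s" "c + t *\<^sub>R \<nu> c \<in> frontier \<Omega>"
        by auto
      then have "t = d c" using front r by simp
      then have "s = d c" using t up[OF s(1)] by simp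
      then show False
        using s(1) rad by (simp add: radial_map_def)
    qed
  qed
qed

lemma thickness_pos:
  assumes "c \<in> frontier C"
  shows "d c > 0"
  using outward_ray_mem_iff[OF assms, of 0] assms frontier_subset subset by auto

lemma mem_iff_dist_less_thickness:
  assumes "y \<notin> C"
  shows "y \<in> \<Omega> \<longleftrightarrow> dist y (closest_point C y) < d (closest_point C y)"
  using outward_ray_mem_iff[OF closest_point_in_frontier[OF assms], of "dist y (closest_point C y)"]
    closest_point_decomposition[OF assms] by simp

text \<open>For a displacement \<open>h\<close> from the radial point, the thickness at the nearest
  point changes by at most \<open>\<epsilon> / 2 * norm h\<close>, while the distance to
  \<open>C\<close> changes to first order by \<open>h \<bullet> \<nu> c\<close>. Outside the double
  cone the second effect wins.\<close>

lemma has_inward_normal_radial_map: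
  assumes c: "c \<in> frontier C"
    and flat: "\<And>\<eta>. \<eta> > 0 \<Longrightarrow> \<exists>\<delta>>0. \<forall>x\<in>frontier C. dist x c < \<delta> \<longrightarrow> \<bar>d x - d c\<bar> \<le> \<eta> * dist x c"
  shows "has_inward_normal \<Omega> (radial_map C \<Omega> c) (- \<nu> c)"
  unfolding has_inward_normal_def
proof (intro conjI allI impI)
  let ?x = "radial_map C \<Omega> c" and ?R = "d c"
  have x: "?x = c + ?R *\<^sub>R \<nu> c" by (simp add: radial_map_def)
  have R: "?R > 0" using thickness_pos[OF c] .
  have n\<nu>: "norm (\<nu> c) = 1" using norm_outward_normal[OF c] .
  have cC: "c \<in> C" using c frontier_subset by blast
  show "?x \<in> frontier \<Omega>" using radial c by blast
  show "norm (- \<nu> c) = 1" using n\<nu> by simp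
  fix \<epsilon> :: real assume \<epsilon>: "\<epsilon> > 0"
  then obtain \<delta>' where \<delta>': "\<delta>' > 0"
    "\<And>x. x \<in> frontier C \<Longrightarrow> dist x c < \<delta>' \<Longrightarrow> \<bar>d x - ?R\<bar> \<le> \<epsilon> / 2 * dist x c"
    using flat[of "\<epsilon> / 2"] by auto
  \<comment> \<open>The three bounds serve the flatness of \<open>d\<close>, the positivity of
    \<open>?R - \<epsilon> / 2 * norm h\<close>, and the absorption of
    \<open>(norm h)\<^sup>2\<close> into \<open>?R * \<epsilon> * norm h\<close>.\<close>
  define \<delta> where "\<delta> = min \<delta>' (min ?R (?R * \<epsilon>))"
  have *: "((y - ?x) \<bullet> - \<nu> c > \<epsilon> * norm (y - ?x) \<longrightarrow> y \<in> \<Omega>) \<and>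
      ((y - ?x) \<bullet> - \<nu> c < - \<epsilon> * norm (y - ?x) \<longrightarrow> y \<notin> \<Omega>)" if y: "dist y ?x < \<delta>" for y
  proof -
    define h where "h = y - ?x"
    define q where "q = closest_point C y"
    have yc: "y - c = ?R *\<^sub>R \<nu> c + h" by (simp add: h_def x)
    have h: "norm h < \<delta>'" "norm h < ?R" "norm h < ?R * \<epsilon>"
      using y by (auto simp: h_def \<delta>_def dist_norm)
    \<comment> \<open>The projection onto \<open>C\<close> is nonexpansive and sends
      \<open>?x\<close> to \<open>c\<close>.\<close>
    have "dist q c \<le> dist y ?x"
      using closest_point_lipschitz[OF convex closed, of y ?x] cC
        closest_point_outward_ray[OF c less_imp_le[OF R]] by (auto simp: q_def x)
    then have qc: "dist q c \<le> norm h" by (simp add: h_def dist_norm)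
    have dq: "\<bar>d q - ?R\<bar> \<le> \<epsilon> / 2 * norm h" if "y \<notin> C"
    proof -
      have "\<bar>d q - ?R\<bar> \<le> \<epsilon> / 2 * dist q c"
        using \<delta>'(2)[of q] closest_point_in_frontier[OF that] qc h by (simp add: q_def)
      also have "\<dots> \<le> \<epsilon> / 2 * norm h"
        using qc \<epsilon> by (intro mult_left_mono) auto
      finally show ?thesis .
    qed
    have yc\<nu>: "(y - c) \<bullet> \<nu> c = ?R + h \<bullet> \<nu> c"
      using n\<nu> by (simp add: yc inner_add_left dot_square_norm)
    have "y \<in> \<Omega>" if less: "h \<bullet> \<nu> c < - \<epsilon> * norm h"
    proof (cases "y \<in> C")
      case True
      then show ?thesis using subset by blast
    next
      case False
      have h0: "norm h > 0" using less by auto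
      have "- (h \<bullet> \<nu> c) \<le> norm h"
        using norm_cauchy_schwarz[of "- h" "\<nu> c"] n\<nu> by simp
      \<comment> \<open>The cone of this case is empty unless \<open>\<epsilon> < 1\<close>; this
        makes the right-hand side nonnegative when the squares are removed below.\<close>
      then have "\<epsilon> * norm h < norm h" using less by simp
      have "(norm (y - c))\<^sup>2 = ?R\<^sup>2 + 2 * ?R * (h \<bullet> \<nu> c) + (norm h)\<^sup>2"
      proof -
        have "\<nu> c \<bullet> \<nu> c = 1" "\<nu> c \<bullet> h = h \<bullet> \<nu> c"
          using n\<nu> by (simp_all add: dot_square_norm inner_commute)
        then show ?thesis
          unfolding yc power2_norm_eq_inner
          by (simp add: inner_add_left inner_add_right power2_eq_square algebra_simps)
      qed
      also have "\<dots> < ?R\<^sup>2 - ?R * \<epsilon> * norm h"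
      proof -
        have "?R * (h \<bullet> \<nu> c) < ?R * (- \<epsilon> * norm h)"
          using less R by (intro mult_strict_left_mono)
        moreover have "norm h * norm h \<le> ?R * \<epsilon> * norm h"
          using h by (intro mult_right_mono) auto
        ultimately show ?thesis by (simp add: power2_eq_square algebra_simps)
      qed
      also have "\<dots> \<le> (?R - \<epsilon> / 2 * norm h)\<^sup>2"
        using zero_le_power2[of "\<epsilon> * norm h"] by (simp add: power2_eq_square algebra_simps)
      finally have "norm (y - c) < ?R - \<epsilon> / 2 * norm h"
        by (rule power2_less_imp_less) (use \<open>\<epsilon> * norm h < norm h\<close> h R in linarith)
      moreover have "dist y q \<le> dist y c"
        using closest_point_le[OF closed cC] by (simp add: q_def)
      ultimately have "dist y q < d q"
        using dq[OF False] unfolding dist_norm by linarith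
      then show ?thesis
        using mem_iff_dist_less_thickness[OF False] by (simp add: q_def)
    qed
    moreover have "y \<notin> \<Omega>" if gr: "h \<bullet> \<nu> c > \<epsilon> * norm h"
    proof -
      have "\<epsilon> * norm h \<ge> 0" using \<epsilon> by simp
      \<comment> \<open>Here \<open>y\<close> is in front of the supporting hyperplane at
        \<open>c\<close> and \<open>q\<close> is not, so \<open>dist y q\<close> is at least the
        height \<open>?R + h \<bullet> \<nu> c\<close>, which exceeds \<open>d q\<close>.\<close>
      then have yC: "y \<notin> C"
        using inner_outward_normal_le[OF c, of y] yc\<nu> gr R by auto
      have "q \<in> C" using closest_point_in_frontier[OF yC] frontier_subset by (auto simp: q_def)
      then have "(q - c) \<bullet> \<nu> c \<le> 0"
        by (rule inner_outward_normal_le[OF c])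
      then have "(y - c) \<bullet> \<nu> c \<le> (y - q) \<bullet> \<nu> c"
        by (simp add: inner_diff_left)
      also have "\<dots> \<le> dist y q"
        using norm_cauchy_schwarz[of "y - q" "\<nu> c"] n\<nu> by (simp add: dist_norm)
      finally have "d q \<le> dist y q"
        using dq[OF yC] yc\<nu> gr \<open>\<epsilon> * norm h \<ge> 0\<close> by linarith
      then show ?thesis
        using mem_iff_dist_less_thickness[OF yC] by (simp add: q_def)
    qed
    ultimately show ?thesis by (simp add: h_def)
  qed
  have "\<delta> > 0" using \<delta>'(1) R \<epsilon> by (simp add: \<delta>_def)
  with * show "\<exists>\<delta>>0. \<forall>y. dist y ?x < \<delta> \<longrightarrow>
      ((y - ?x) \<bullet> - \<nu> c > \<epsilon> * norm (y - ?x) \<longrightarrow> y \<in> \<Omega>) \<and>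
      ((y - ?x) \<bullet> - \<nu> c < - \<epsilon> * norm (y - ?x) \<longrightarrow> y \<notin> \<Omega>)"
    by blast
qed

text \<open>At parameters below \<open>d c\<close> the returning half-line is still strictly in
  front of the supporting hyperplane at \<open>c\<close>; at \<open>d c\<close> it reaches
  \<open>c\<close> itself.\<close>

lemma return_map_fixed:
  assumes c: "c \<in> frontier C" and "has_inward_normal \<Omega> (radial_map C \<Omega> c) (- \<nu> c)"
  shows "return_map C \<Omega> c = c"
proof -
  let ?x = "radial_map C \<Omega> c"
  have n: "inward_normal \<Omega> ?x = - \<nu> c"
    using assms(2) by (rule inward_normal_eq)
  have "Inf {t. t \<ge> 0 \<and> ?x + t *\<^sub>R - \<nu> c \<in> C} = d c"
  proof (rule cInf_eq_minimum)
    show "d c \<in> {t. t \<ge> 0 \<and> ?x + t *\<^sub>R - \<nu> c \<in> C}"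
      using thickness_nonneg[OF c] c frontier_subset by (auto simp: radial_map_def)
    fix t assume "t \<in> {t. t \<ge> 0 \<and> ?x + t *\<^sub>R - \<nu> c \<in> C}"
    then have "(?x + t *\<^sub>R - \<nu> c - c) \<bullet> \<nu> c \<le> 0"
      using inner_outward_normal_le[OF c] by blast
    then show "d c \<le> t"
      using norm_outward_normal[OF c]
      by (simp add: radial_map_def inner_diff_left inner_add_left dot_square_norm)
  qed
  then show ?thesis
    by (simp add: return_map_def reciprocal_map_def n) (simp add: radial_map_def)
qed

lemma extremum_in_fixed_points:
  assumes "C2_function_on (frontier C) d" and c: "c \<in> frontier C"
    and "(\<forall>x\<in>frontier C. d x \<le> d c) \<or> (\<forall>x\<in>frontier C. d c \<le> d x)"
  shows "c \<in> fixed_points (frontier C) (return_map C \<Omega>)"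
  unfolding fixed_points_def
  using return_map_fixed[OF c has_inward_normal_radial_map[OF c flat_at_extremum[OF smooth assms]]] c
  by blast

text \<open>If the chosen maximum and minimum points coincide, \<open>d\<close> is constant and
  every boundary point is an extremum; then \<open>a\<close> and \<open>b\<close> serve.\<close>

lemma two_fixed_points:
  assumes C2: "C2_function_on (frontier C) d" and two: "a \<in> frontier C" "b \<in> frontier C" "a \<noteq> b"
  obtains x y where "x \<noteq> y" "{x, y} \<subseteq> fixed_points (frontier C) (return_map C \<Omega>)"
proof -
  have co: "compact (frontier C)" "continuous_on (frontier C) d"
    using compact compact_frontier continuous_on_C2_function[OF smooth C2] by auto
  obtain x where x: "x \<in> frontier C" "\<And>z. z \<in> frontier C \<Longrightarrow> d z \<le> d x"
    using continuous_attains_sup[OF co(1) _ co(2)] two by blast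
  obtain y where y: "y \<in> frontier C" "\<And>z. z \<in> frontier C \<Longrightarrow> d y \<le> d z"
    using continuous_attains_inf[OF co(1) _ co(2)] two by blast
  show thesis
  proof (cases "x = y")
    case False
    then show ?thesis
      using extremum_in_fixed_points[OF C2] x y by (intro that[of x y]) auto
  next
    case True
    then have "d z = d x" if "z \<in> frontier C" for z
      using x y that by (intro antisym) auto
    then show ?thesis
      using extremum_in_fixed_points[OF C2] two by (intro that[of a b]) auto
  qed
qed

end

theorem theorem5p3:
  fixes C \<Omega> :: "'a::euclidean_space set"
  assumes "compact C" and "convex C" and "interior C \<noteq> {}"
    and "C2_hypersurface (frontier C)"
    and "open \<Omega>" and "connected \<Omega>" and "bounded \<Omega>" and "C \<subseteq> \<Omega>"
    and "class_O C \<Omega>"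
    and "bij_betw (radial_map C \<Omega>) (frontier C) (frontier \<Omega> - C)"
    and "C2_function_on (frontier C) (thickness C \<Omega>)"
    and "Morse_on (frontier C) (thickness C \<Omega>)"
  shows "ecard (fixed_points (frontier C) (return_map C \<Omega>))
           \<ge> (\<Sum>k = 0..DIM('a) - 1. betti_number k (top_of_set (frontier C)))"
proof -
  interpret radial_domain C \<Omega>
    using assms by unfold_locales (auto simp: bij_betw_def)
  obtain f g where fg: "homeomorphism (frontier C) (sphere (0::'a) 1) f g"
    using frontier_convex_homeomorphic_sphere[OF assms(1-3)] by (auto simp: homeomorphic_def)
  \<comment> \<open>Two distinct boundary points come from an antipodal pair on the sphere, which
    exists in dimension 1 as well.\<close>
  obtain b :: 'a where "b \<in> Basis"
    using nonempty_Basis by blast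
  then have b: "b \<in> sphere 0 1" "- b \<in> sphere 0 1" and bb: "b \<bullet> b = 1"
    by (simp_all add: norm_Basis)
  have "b \<noteq> - b"
  proof
    assume "b = - b"
    then have "b \<bullet> b = (- b) \<bullet> b" by (rule arg_cong)
    then have "b \<bullet> b = - (b \<bullet> b)" unfolding inner_minus_left .
    with bb show False by linarith
  qed
  moreover have "f (g x) = x" if "x \<in> sphere 0 1" for x
    using homeomorphism_apply2[OF fg that] .
  ultimately have gne: "g b \<noteq> g (- b)"
    using b(1,2) by (intro notI) metis
  have gb: "g b \<in> frontier C" "g (- b) \<in> frontier C" "g b \<noteq> g (- b)"
    using homeomorphism_image2[OF fg] b gne by blast+
  obtain x y where xy: "x \<noteq> y" "{x, y} \<subseteq> fixed_points (frontier C) (return_map C \<Omega>)"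
    using two_fixed_points[OF assms(11) gb] by blast
  have "(2::enat) \<le> ecard (fixed_points (frontier C) (return_map C \<Omega>))"
  proof (cases "finite (fixed_points (frontier C) (return_map C \<Omega>))")
    case True
    then have "2 \<le> card (fixed_points (frontier C) (return_map C \<Omega>))"
      using card_mono[OF True xy(2)] xy(1) by simp
    then show ?thesis
      using True by (simp add: ecard_def numeral_eq_enat)
  qed (simp add: ecard_def)
  then show ?thesis
    using sum_betti_numbers_frontier_convex_le[OF assms(1-3)] by (rule order_trans[rotated])
qed

end
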